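(* Let $m\ge2$ and let the sequences $(a_n)_{n\ge0}$, $(b_n)_{n\ge0}$ satisfy $a_j=b_j$ for $0\le j\le m-2$ and $$a_n=b_n+\frac{m}{\binom{n}{m-1}}\sum_{j=0}^{n-(m-1)}\binom{n-1-j}{m-2}a_j,\qquad n\ge m-1 .$$ Let $A(z)=\sum_{n\ge0}a_nz^n$, $B(z)=\sum_{n\ge0}b_nz^n$ and $\hat B(z)=\sum_{n\ge m-1}b_nz^n$. Let $$\psi(\lambda)=\lambda(\lambda+1)\cdots(\lambda+m-2)-m!$$ with roots $2=\lambda_1,\lambda_2,\dots,\lambda_{m-1}$ in nonincreasing order of real parts. Then $$A(z)=\sum_{j=1}^{m-1}c_j(1-z)^{-\lambda_j}+\sum_{j=1}^{m-1}\frac{(1-z)^{-\lambda_j}}{\psi'(\lambda_j)}\int_0^zB^{(m-1)}(\zeta)(1-\zeta)^{\lambda_j+m-2}\,d\zeta$$ $$\phantom{A(z)}=\sum_{j=1}^{m-1}c_j(1-z)^{-\lambda_j}+\hat B(z)+m!\sum_{j=1}^{m-1}\frac{(1-z)^{-\lambda_j}}{\psi'(\lambda_j)}\int_0^z\hat B(\zeta)(1-\zeta)^{\lambda_j-1}\,d\zeta,$$ where $$c_j=\frac{m!}{\psi'(\lambda_j)}\sum_{k=0}^{m-2}b_k\frac{k!}{\lambda_j(\lambda_j+1)\cdots(\lambda_j+k)},\qquad j=1,\dots,m-1 .$$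
   Context: The $m-1$ roots of $\psi$ are distinct and nonzero. The identities are between (ordinary) generating functions, i.e. power series in $z$: $(1-z)^{s}$ denotes its binomial series at $0$, $B^{(m-1)}$ is the $(m-1)$st derivative, and integrals from $0$ to $z$ are taken termwise (equivalently, as analytic functions near $0$ when the series converge). *)

theory Defs
  imports "HOL-Computational_Algebra.Computational_Algebra"
begin

definition psi :: "nat \<Rightarrow> complex poly" where
  "psi m = (\<Prod>k<m - 1. [:of_nat k, 1:]) - [:fact m:]"

text \<open>The binomial series of \<open>(1 - z)\<close> to the power \<open>s\<close>: \<open>fps_binomial s\<close> is the
  binomial series of \<open>(1 + z)\<close> to the power \<open>s\<close>.\<close>

definition one_minus_z_powr :: "complex \<Rightarrow> complex fps" where
  "one_minus_z_powr s = fps_binomial s oo (- fps_X)"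

end

theory Submission
  imports Defs
begin

text \<open>Let \<open>N = m - 1\<close> and \<open>\<theta> = (1 - z) d/dz\<close>. The operators \<open>(1 - z)^k d^k/dz^k\<close> are the
  rising factorials of \<open>\<theta>\<close>, so that \<open>\<psi>(\<theta>) H = (1 - z)^N H^(N) - m! H\<close>. Lagrange interpolation at
  the roots writes \<open>H = \<Sum>\<^sub>j F\<^sub>j / \<psi>'(\<lambda>\<^sub>j)\<close> with \<open>F\<^sub>j = (\<psi>(\<theta>) / (\<theta> - \<lambda>\<^sub>j)) H\<close>, and each \<open>F\<^sub>j\<close> solves
  the first-order equation \<open>(\<theta> - \<lambda>\<^sub>j) F\<^sub>j = \<psi>(\<theta>) H\<close>. The recurrence says that
  \<open>\<psi>(\<theta>) A = (1 - z)^N B^(N)\<close>, so \<open>H = A\<close> gives the first formula; \<open>H = Bhat\<close> then gives the second.\<close>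

section \<open>Binomial series in \<open>1 - z\<close>\<close>

lemma one_minus_z_powr_nth: "one_minus_z_powr s $ n = (-1) ^ n * (s gchoose n)"
  by (simp add: one_minus_z_powr_def fps_compose_uminus')

lemma one_minus_z_powr_0 [simp]: "one_minus_z_powr 0 = 1"
  by (simp add: one_minus_z_powr_def)

lemma one_minus_z_powr_add:
  "one_minus_z_powr (s + t) = one_minus_z_powr s * one_minus_z_powr t"
  by (simp add: one_minus_z_powr_def fps_binomial_add_mult fps_compose_mult_distrib)

lemma one_minus_z_powr_uminus_mult: "one_minus_z_powr (- s) * one_minus_z_powr s = 1"
  by (simp flip: one_minus_z_powr_add)

lemma fps_deriv_one_minus_z_powr:
  "fps_deriv (one_minus_z_powr s) = - (fps_const s * one_minus_z_powr (s - 1))"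
proof (rule fps_ext)
  fix n
  have "of_nat (Suc n) * (s gchoose Suc n) = s * ((s - 1) gchoose n)"
    by (rule gbinomial_absorption)
  then have "(-1) ^ Suc n * (of_nat (Suc n) * (s gchoose Suc n)) = (-1) ^ Suc n * (s * ((s - 1) gchoose n))"
    by (simp only:)
  then show "fps_deriv (one_minus_z_powr s) $ n = (- (fps_const s * one_minus_z_powr (s - 1))) $ n"
    by (simp add: one_minus_z_powr_nth mult_ac)
qed

text \<open>For \<open>N = m - 1\<close> these are the weights in the recurrence, whose sum is thus
  a coefficient of \<open>one_minus_z_powr (- of_nat N) * A\<close>.\<close>

lemma one_minus_z_powr_uminus_of_nat_nth:
  assumes "N > 0"
  shows "one_minus_z_powr (- of_nat N) $ n = of_nat ((n + N - 1) choose (N - 1))"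
proof -
  have "one_minus_z_powr (- of_nat N) $ n = (of_nat (n + N - 1) gchoose n :: complex)"
    using assms by (simp add: one_minus_z_powr_nth gbinomial_minus of_nat_diff add.commute
        flip: power_add mult.assoc)
  also have "\<dots> = of_nat ((n + N - 1) choose n)"
    by (simp add: binomial_gbinomial)
  also have "(n + N - 1) choose n = (n + N - 1) choose (N - 1)"
    using assms by (subst binomial_symmetric) auto
  finally show ?thesis .
qed

lemma fps_const_fact: "fps_const (fact n :: 'a :: semiring_char_0) = fact n"
  by (metis fps_of_nat of_nat_fact)

lemma fps_const_sum: "fps_const (\<Sum>i\<in>S. f i) = (\<Sum>i\<in>S. fps_const (f i))"
  by (rule fps_ext) (simp add: fps_sum_nth)

lemma fps_nth_deriv_nth:
  fixes f :: "'a :: comm_semiring_1 fps"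
  shows "fps_nth_deriv k f $ n = pochhammer (of_nat n + 1) k * f $ (n + k)"
proof (induction k arbitrary: f)
  case (Suc k)
  then show ?case
    by (simp add: pochhammer_rec' algebra_simps)
qed simp

section \<open>First-order equations and the operator \<theta>\<close>

text \<open>Integrating factor: multiplication by \<open>(1 - z)^s\<close> turns
  \<open>\<theta> - s\<close> into \<open>d/dz\<close>, up to the factor
  \<open>(1 - z)^(s - 1)\<close>.\<close>

lemma fps_deriv_one_minus_z_powr_mult:
  "fps_deriv (one_minus_z_powr s * F) =
     one_minus_z_powr (s - 1) * (one_minus_z_powr 1 * fps_deriv F - fps_const s * F)"
proof -
  have "one_minus_z_powr s = one_minus_z_powr (s - 1) * one_minus_z_powr 1"
    by (simp flip: one_minus_z_powr_add)
  moreover have "fps_deriv (one_minus_z_powr s * F) =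
      one_minus_z_powr s * fps_deriv F - fps_const s * one_minus_z_powr (s - 1) * F"
    by (simp add: fps_deriv_one_minus_z_powr)
  ultimately show ?thesis
    by (simp add: algebra_simps)
qed

text \<open>Integrate the preceding identity from 0; the constant is \<open>F $ 0\<close> because
  \<open>(1 - z)^s\<close> has constant coefficient 1.\<close>

lemma one_minus_z_powr_first_order:
  assumes "one_minus_z_powr 1 * fps_deriv F - fps_const s * F = G"
  shows "F = one_minus_z_powr (- s) *
           (fps_const (F $ 0) + fps_integral0 (one_minus_z_powr (s - 1) * G))"
proof -
  have "fps_integral0 (one_minus_z_powr (s - 1) * G) = one_minus_z_powr s * F - fps_const (F $ 0)"
    using fps_integral0_deriv[of "one_minus_z_powr s * F"] assms
    by (simp add: fps_deriv_one_minus_z_powr_mult one_minus_z_powr_nth del: fps_deriv_mult)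
  then show ?thesis
    by (simp add: one_minus_z_powr_uminus_mult flip: mult.assoc)
qed

text \<open>This is \<open>(\<theta> + k) T_k = T_(k+1)\<close> for
  \<open>T_k = (1 - z)^k H^(k)\<close>, the step that makes \<open>T_k\<close> the
  \<open>k\<close>-th rising factorial of \<theta> applied to \<open>H\<close>.\<close>

lemma theta_one_minus_z_powr_nth_deriv:
  "one_minus_z_powr 1 * fps_deriv (one_minus_z_powr (of_nat k) * fps_nth_deriv k H) =
     one_minus_z_powr (of_nat (Suc k)) * fps_nth_deriv (Suc k) H
     - of_nat k * (one_minus_z_powr (of_nat k) * fps_nth_deriv k H)"
proof -
  have "one_minus_z_powr 1 * one_minus_z_powr (of_nat k - 1) = one_minus_z_powr (of_nat k)"
    by (simp flip: one_minus_z_powr_add)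
  moreover have "one_minus_z_powr 1 * one_minus_z_powr (of_nat k) = one_minus_z_powr (of_nat (Suc k))"
    by (simp flip: one_minus_z_powr_add)
  moreover have "one_minus_z_powr 1 * fps_deriv (one_minus_z_powr (of_nat k) * fps_nth_deriv k H) =
     (one_minus_z_powr 1 * one_minus_z_powr (of_nat k)) * fps_nth_deriv (Suc k) H
     - of_nat k * ((one_minus_z_powr 1 * one_minus_z_powr (of_nat k - 1)) * fps_nth_deriv k H)"
    by (simp add: fps_deriv_one_minus_z_powr fps_nth_deriv_commute fps_of_nat algebra_simps
        del: fps_nth_deriv.simps)
  ultimately show ?thesis
    by simp
qed

section \<open>Lagrange interpolation\<close>

text \<open>\<open>f\<close> equals its interpolant \<open>g\<close> at the \<open>card I\<close>
  distinct nodes, and every basis polynomial \<open>w j\<close> is monic of degree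
  \<open>card I - 1\<close>; compare the coefficients of that degree.\<close>

lemma lagrange_sum_eq_coeff:
  fixes l :: "'i \<Rightarrow> 'a :: field"
  assumes "finite I" and inj: "inj_on l I" and deg: "degree f < card I"
  shows "(\<Sum>j\<in>I. poly f (l j) / (\<Prod>i\<in>I - {j}. l j - l i)) = coeff f (card I - 1)"
proof -
  define w where "w j = (\<Prod>i\<in>I - {j}. [:- l i, 1:])" for j
  define g where "g = (\<Sum>j\<in>I. smult (poly f (l j) / poly (w j) (l j)) (w j))"
  have w: "poly (w j) (l j) = (\<Prod>i\<in>I - {j}. l j - l i)" for j
    by (simp add: w_def poly_prod)
  have w_nonzero: "poly (w j) (l j) \<noteq> 0" if "j \<in> I" for j
    using that assms by (auto simp: w inj_on_def)
  have w_zero: "poly (w j) (l i) = 0" if "i \<in> I" "i \<noteq> j" for i j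
    using that assms(1) by (auto simp: w_def poly_prod)
  have deg_w: "degree (w j) = card I - 1" if "j \<in> I" for j
    using that assms(1) by (simp add: w_def degree_prod_eq_sum_degree)
  have lead_w: "coeff (w j) (card I - 1) = 1" if "j \<in> I" for j
    using lead_coeff_prod[of "\<lambda>i. [:- l i, 1:]" "I - {j}"] deg_w[OF that] by (simp add: w_def)
  have "f = g"
  proof (rule poly_eqI_degree)
    fix x assume "x \<in> l ` I"
    then obtain i where i: "i \<in> I" "x = l i" by auto
    have "poly g x = (\<Sum>j\<in>I. if j = i then poly f (l i) else 0)"
      unfolding g_def poly_sum by (rule sum.cong) (use i w_zero w_nonzero in auto)
    then show "poly f x = poly g x"
      using i assms(1) by simp
  next
    show "degree f < card (l ` I)"
      using deg inj by (simp add: card_image)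
    have "degree g \<le> card I - 1"
      unfolding g_def using assms(1) deg_w
      by (intro degree_sum_le) (auto intro: order.trans[OF degree_smult_le])
    then show "degree g < card (l ` I)"
      using deg inj by (simp add: card_image)
  qed
  then have "coeff f (card I - 1) = coeff g (card I - 1)"
    by (rule arg_cong[of _ _ "\<lambda>p. coeff p (card I - 1)"])
  also have "\<dots> = (\<Sum>j\<in>I. poly f (l j) / poly (w j) (l j) * coeff (w j) (card I - 1))"
    by (simp add: g_def coeff_sum)
  also have "\<dots> = (\<Sum>j\<in>I. poly f (l j) / poly (w j) (l j))"
    by (intro sum.cong) (simp_all only: lead_w mult_1_right)
  finally show ?thesis
    by (simp add: w)
qed

section \<open>Simplicity of the roots of \<psi>\<close>

lemma abs_pochhammer_le_fact:
  fixes x :: real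
  assumes "- real n \<le> x" "x \<le> 0"
  shows "\<bar>pochhammer x (Suc n)\<bar> \<le> fact n"
  using assms
proof (induction n)
  case (Suc n)
  show ?case
  proof (cases "- real n \<le> x")
    case True
    have "\<bar>pochhammer x (Suc n)\<bar> * \<bar>x + real (Suc n)\<bar> \<le> fact n * real (Suc n)"
      using Suc.IH[OF True] Suc.prems True by (intro mult_mono) auto
    then show ?thesis
      by (subst pochhammer_Suc, subst abs_mult) (simp add: mult.commute)
  next
    \<comment> \<open>Now \<open>x\<close> lies between \<open>-(n + 1)\<close> and
      \<open>-n\<close>: each \<open>|x + i|\<close> with \<open>i \<le> n\<close> is at most
      \<open>n + 1 - i\<close>, so these factors already give the bound \<open>(n + 1)!\<close>, and
      the last factor is at most 1.\<close>
    case False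
    have "\<bar>pochhammer x (Suc n)\<bar> = (\<Prod>i = 0..n. \<bar>x + real i\<bar>)"
      by (simp add: pochhammer_Suc_prod abs_prod)
    also have "\<dots> \<le> (\<Prod>i = 0..n. real (Suc n - i))"
      using Suc.prems False by (intro prod_mono) (auto simp: of_nat_diff)
    also have "\<dots> = real (\<Prod>i = 0..n. Suc n - i)"
      by simp
    also have "(\<Prod>i = 0..n. Suc n - i) = fact (Suc n)"
      using fact_prod_rev[of "Suc n", where 'a = nat]
      by (simp add: atLeastLessThanSuc_atLeastAtMost)
    finally have "\<bar>pochhammer x (Suc n)\<bar> * \<bar>x + real (Suc n)\<bar> \<le> fact (Suc n) * 1"
      using Suc.prems False by (intro mult_mono) (auto simp: algebra_simps)
    then show ?thesis
      by (subst pochhammer_Suc, subst abs_mult) (simp only: mult_1_right)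
  qed
qed simp

lemma poly_psi: "poly (psi m) x = pochhammer x (m - 1) - fact m"
  by (simp add: psi_def poly_prod pochhammer_prod lessThan_atLeast0 add.commute)

text \<open>At a double root the logarithmic derivative \<open>\<Sum> 1 / (z + k)\<close> vanishes, which forces
  \<open>z\<close> to be real and between \<open>-(m - 2)\<close> and \<open>0\<close>, where the product is too small to equal \<open>m!\<close>.\<close>

lemma poly_pderiv_psi_nonzero:
  assumes "m \<ge> 2" and root: "poly (psi m) z = 0"
  shows "poly (pderiv (psi m)) z \<noteq> 0"
proof
  assume d0: "poly (pderiv (psi m)) z = 0"
  obtain n where m: "m = Suc (Suc n)"
    using assms(1) by (metis Suc_1 le_Suc_ex plus_nat.simps(2) add_2_eq_Suc)
  have p: "pochhammer z (Suc n) = fact m"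
    using root by (simp add: poly_psi m)
  have nz: "z + of_nat k \<noteq> 0" if "k \<le> n" for k
  proof
    assume "z + of_nat k = 0"
    then have "pochhammer z (Suc n) = 0"
      using that by (auto simp: pochhammer_eq_0_iff eq_neg_iff_add_eq_0 intro!: exI[of _ k])
    then show False using p by simp
  qed
  \<comment> \<open>The constant \<open>m!\<close> drops out, so the derivative is
    \<open>pochhammer z (Suc n)\<close> times the sum of \<open>1 / (z + k)\<close>. The first
    factor is \<open>m!\<close>, hence nonzero, and cancels.\<close>
  have "poly (pderiv (psi m)) z = (\<Sum>k\<le>n. \<Prod>i\<in>{..n} - {k}. z + of_nat i)"
    by (simp add: psi_def m lessThan_Suc_atMost pderiv_diff pderiv_prod pderiv_pCons poly_sum
        poly_prod add.commute)
  also have "\<dots> = (\<Sum>k\<le>n. pochhammer z (Suc n) * inverse (z + of_nat k))"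
  proof (rule sum.cong)
    fix k assume k: "k \<in> {..n}"
    have "pochhammer z (Suc n) = (z + of_nat k) * (\<Prod>i\<in>{..n} - {k}. z + of_nat i)"
      using k by (simp add: pochhammer_Suc_prod atMost_atLeast0 prod.remove)
    then show "(\<Prod>i\<in>{..n} - {k}. z + of_nat i) = pochhammer z (Suc n) * inverse (z + of_nat k)"
      using nz k by (simp add: field_simps)
  qed simp
  finally have s0: "(\<Sum>k\<le>n. inverse (z + of_nat k)) = 0"
    using d0 p by (simp flip: sum_distrib_left)
  \<comment> \<open>As \<open>1 / w = cnj w / |w|^2\<close>, the vanishing sum combines the
    conjugates of \<open>z + k\<close> with positive weights. Its imaginary part forces
    \<open>Im z = 0\<close>; its real part makes \<open>x\<close> a weighted mean of the numbers
    \<open>-k\<close> with \<open>k \<le> n\<close>.\<close>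
  define r where "r k = inverse ((cmod (z + of_nat k))\<^sup>2)" for k
  have r_pos: "r k > 0" if "k \<le> n" for k
    using nz[OF that] by (simp add: r_def)
  have inv: "inverse (z + of_nat k) = of_real (r k) * cnj (z + of_nat k)" for k
    using complex_div_cnj[of 1 "z + of_nat k"] by (simp add: r_def inverse_eq_divide)
  have "Im (\<Sum>k\<le>n. inverse (z + of_nat k)) = - (Im z * (\<Sum>k\<le>n. r k))"
    by (simp add: inv sum_distrib_left sum_negf algebra_simps)
  moreover have "(\<Sum>k\<le>n. r k) > 0"
    using r_pos by (intro sum_pos) auto
  ultimately have im: "Im z = 0"
    using s0 by simp
  define x where "x = Re z"
  have z: "z = of_real x"
    using im by (simp add: x_def complex_eq_iff)
  have re: "(\<Sum>k\<le>n. r k * (x + real k)) = 0"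
  proof -
    have "Re (\<Sum>k\<le>n. inverse (z + of_nat k)) = (\<Sum>k\<le>n. r k * (x + real k))"
      by (simp add: inv x_def)
    then show ?thesis using s0 by simp
  qed
  have "x \<le> 0"
  proof (rule ccontr)
    assume "\<not> x \<le> 0"
    then have "(\<Sum>k\<le>n. r k * (x + real k)) > 0"
      using r_pos by (intro sum_pos) auto
    then show False using re by simp
  qed
  moreover have "- real n \<le> x"
  proof (rule ccontr)
    assume "\<not> - real n \<le> x"
    then have "(\<Sum>k\<le>n. - (r k * (x + real k))) > 0"
      using r_pos by (intro sum_pos) (auto simp: mult_pos_neg)
    then show False using re by (simp add: sum_negf)
  qed
  ultimately have "\<bar>pochhammer x (Suc n)\<bar> \<le> fact n"
    by (intro abs_pochhammer_le_fact)
  moreover have "pochhammer x (Suc n) = fact m"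
  proof -
    have "complex_of_real (pochhammer x (Suc n)) = of_real (fact m)"
      using p by (simp add: z pochhammer_of_real[symmetric])
    then show ?thesis by (simp only: of_real_eq_iff)
  qed
  moreover have "fact n < (fact m :: real)"
  proof -
    have "fact n \<le> (fact (Suc n) :: real)"
      by (rule fact_mono) simp
    also have "\<dots> < fact (Suc (Suc n))"
      by (rule fact_less_mono) auto
    finally show ?thesis by (simp only: m)
  qed
  ultimately show False by simp
qed

text \<open>In the product rule every summand except the one that omits index \<open>j\<close> keeps
  the factor \<open>l j - l j\<close>.\<close>

lemma poly_pderiv_prod_linear:
  fixes l :: "'i \<Rightarrow> 'a :: idom"
  assumes "finite I" "j \<in> I"
  shows "poly (pderiv (\<Prod>i\<in>I. [:- l i, 1:])) (l j) = (\<Prod>i\<in>I - {j}. l j - l i)"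
proof -
  have "poly (pderiv (\<Prod>i\<in>I. [:- l i, 1:])) (l j) = (\<Sum>k\<in>I. \<Prod>i\<in>I - {k}. l j - l i)"
    by (simp add: pderiv_prod pderiv_pCons poly_sum poly_prod)
  also have "\<dots> = (\<Sum>k\<in>I. if k = j then \<Prod>i\<in>I - {j}. l j - l i else 0)"
    using assms by (intro sum.cong) (auto intro!: prod_zero)
  finally show ?thesis using assms by simp
qed

section \<open>Expansion of a power series over the roots\<close>

context
  fixes m :: nat and lam :: "nat \<Rightarrow> complex"
  assumes m: "m \<ge> 2" and psi_eq: "psi m = (\<Prod>j = 1..m - 1. [:- lam j, 1:])"
begin

lemma psi_root: "j \<in> {1..m - 1} \<Longrightarrow> poly (psi m) (lam j) = 0"
  by (auto simp: psi_eq poly_prod)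

lemma pochhammer_root: "j \<in> {1..m - 1} \<Longrightarrow> pochhammer (lam j) (m - 1) = fact m"
  using psi_root[of j] by (simp add: poly_psi)

text \<open>A vanishing factor would persist in \<open>pochhammer (lam j) (m - 1)\<close>, which is
  \<open>m!\<close>.\<close>

lemma pochhammer_root_nonzero:
  assumes "j \<in> {1..m - 1}" "k \<le> m - 1"
  shows "pochhammer (lam j) k \<noteq> 0"
  using pochhammer_eq_0_mono[OF _ assms(2), of "lam j"] pochhammer_root[OF assms(1)] by auto

lemma poly_pderiv_psi_root:
  "j \<in> {1..m - 1} \<Longrightarrow> poly (pderiv (psi m)) (lam j) = (\<Prod>i\<in>{1..m - 1} - {j}. lam j - lam i)"
  unfolding psi_eq by (intro poly_pderiv_prod_linear) auto

text \<open>The factorisation lists roots with multiplicity; a repetition would put a zero factor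
  into \<open>\<psi>'(lam j)\<close>, which is nonzero at every root.\<close>

lemma inj_on_roots: "inj_on lam {1..m - 1}"
proof (rule inj_onI, rule ccontr)
  fix i j assume ij: "i \<in> {1..m - 1}" "j \<in> {1..m - 1}" "lam i = lam j" "i \<noteq> j"
  have "(\<Prod>i\<in>{1..m - 1} - {j}. lam j - lam i) = 0"
    using ij by (intro prod_zero bexI[of _ i]) auto
  then show False
    using poly_pderiv_psi_nonzero[OF m psi_root[OF ij(2)]] poly_pderiv_psi_root[OF ij(2)] by simp
qed

text \<open>At a root \<open>m!\<close> is the full rising factorial, so the first quotient is the
  value at \<open>lam j\<close> of the product \<open>f\<close> of the uncancelled factors, monic of
  degree \<open>m - 2 - k\<close>. The Lagrange sum extracts its coefficient of degree
  \<open>m - 2\<close>.\<close>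

lemma sum_inverse_pochhammer_roots:
  assumes "k < m - 1"
  shows "(\<Sum>j = 1..m - 1. fact m / pochhammer (lam j) (Suc k) / poly (pderiv (psi m)) (lam j)) =
           (if k = 0 then 1 else 0)"
proof -
  define f :: "complex poly" where "f = (\<Prod>i\<in>{Suc k..<m - 1}. [:of_nat i, 1:])"
  have deg: "degree f = m - 2 - k"
    by (simp add: f_def degree_prod_eq_sum_degree)
  have lead: "lead_coeff f = 1"
    by (simp add: f_def lead_coeff_prod)
  have f: "poly f (lam j) = fact m / pochhammer (lam j) (Suc k)" if "j \<in> {1..m - 1}" for j
  proof -
    have "pochhammer (lam j) (m - 1) = pochhammer (lam j) (Suc k) * poly f (lam j)"
      using assms prod.atLeastLessThan_concat[of 0 "Suc k" "m - 1" "\<lambda>i. lam j + of_nat i"]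
      by (simp add: pochhammer_prod f_def poly_prod add.commute)
    then show ?thesis
      using pochhammer_root[OF that] pochhammer_root_nonzero[OF that, of "Suc k"] assms
      by (simp add: field_simps)
  qed
  have "(\<Sum>j = 1..m - 1. fact m / pochhammer (lam j) (Suc k) / poly (pderiv (psi m)) (lam j)) =
          (\<Sum>j = 1..m - 1. poly f (lam j) / (\<Prod>i\<in>{1..m - 1} - {j}. lam j - lam i))"
    by (intro sum.cong) (simp_all add: f poly_pderiv_psi_root)
  also have "\<dots> = coeff f (card {1..m - 1} - 1)"
    using assms by (intro lagrange_sum_eq_coeff inj_on_roots) (auto simp: deg)
  also have "\<dots> = (if k = 0 then 1 else 0)"
    using lead deg assms by (auto simp: coeff_eq_0)
  finally show ?thesis .
qed

text \<open>Stated for arbitrary \<open>H\<close>, to be used for both \<open>A\<close> and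
  \<open>Bhat\<close>. The last bracket is \<open>\<psi>(\<theta>) H\<close>, and the constants are
  the values \<open>F_j(0)\<close>.\<close>

lemma fps_expansion_over_roots:
  "H = (\<Sum>j = 1..m - 1. fps_const (1 / poly (pderiv (psi m)) (lam j)) * one_minus_z_powr (- lam j) *
         (fps_const (\<Sum>k<m - 1. fact m / pochhammer (lam j) (Suc k) * (fact k * H $ k)) +
          fps_integral0 (one_minus_z_powr (lam j - 1) *
            (one_minus_z_powr (of_nat (m - 1)) * fps_nth_deriv (m - 1) H - fact m * H))))"
proof -
  define T where "T k = one_minus_z_powr (of_nat k) * fps_nth_deriv k H" for k
  \<comment> \<open>\<open>\<alpha> j (Suc k)\<close> is the coefficient of the \<open>k\<close>-th
    rising factorial of \<open>x\<close> in \<open>\<psi>(x) / (x - lam j)\<close>, so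
    \<open>F j\<close> is this quotient at \<theta>, applied to \<open>H\<close>.\<close>
  define \<alpha> where "\<alpha> j k = fact m / pochhammer (lam j) k" for j k
  define F where "F j = (\<Sum>k<m - 1. fps_const (\<alpha> j (Suc k)) * T k)" for j
  define d where "d j = poly (pderiv (psi m)) (lam j)" for j
  have T_nth_0: "T k $ 0 = fact k * H $ k" for k
    by (simp add: T_def one_minus_z_powr_nth fps_nth_deriv_nth flip: pochhammer_fact)
  have F_nth_0: "F j $ 0 = (\<Sum>k<m - 1. \<alpha> j (Suc k) * (fact k * H $ k))" for j
    by (simp add: F_def fps_sum_nth T_nth_0)
  have ode: "one_minus_z_powr 1 * fps_deriv (F j) - fps_const (lam j) * F j = T (m - 1) - fact m * H"
    if j: "j \<in> {1..m - 1}" for j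
  proof -
    have "one_minus_z_powr 1 * fps_deriv (F j) - fps_const (lam j) * F j =
        (\<Sum>k<m - 1. fps_const (\<alpha> j (Suc k)) *
           (one_minus_z_powr 1 * fps_deriv (T k) - fps_const (lam j) * T k))"
      by (simp add: F_def fps_deriv_sum sum_distrib_left algebra_simps flip: sum_subtractf)
    \<comment> \<open>\<open>(\<theta> - lam j) T k = T (Suc k) - (lam j + k) T k\<close>, and the
      factor \<open>lam j + k\<close> turns \<open>\<alpha> j (Suc k)\<close> into
      \<open>\<alpha> j k\<close>; hence the sum telescopes.\<close>
    also have "\<dots> = (\<Sum>k<m - 1. fps_const (\<alpha> j (Suc k)) * T (Suc k) - fps_const (\<alpha> j k) * T k)"
    proof (rule sum.cong)
      fix k assume k: "k \<in> {..<m - 1}"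
      have "lam j + of_nat k \<noteq> 0" "pochhammer (lam j) k \<noteq> 0"
        using pochhammer_root_nonzero[OF j, of "Suc k"] k by (auto simp: pochhammer_Suc)
      then have "\<alpha> j k = \<alpha> j (Suc k) * (lam j + of_nat k)"
        by (simp add: \<alpha>_def pochhammer_Suc)
      then have \<alpha>: "fps_const (\<alpha> j k) = fps_const (\<alpha> j (Suc k)) * (fps_const (lam j) + of_nat k)"
        by (simp flip: fps_of_nat)
      have "one_minus_z_powr 1 * fps_deriv (T k) = T (Suc k) - of_nat k * T k"
        unfolding T_def by (rule theta_one_minus_z_powr_nth_deriv)
      then show "fps_const (\<alpha> j (Suc k)) *
           (one_minus_z_powr 1 * fps_deriv (T k) - fps_const (lam j) * T k) =
          fps_const (\<alpha> j (Suc k)) * T (Suc k) - fps_const (\<alpha> j k) * T k"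
        by (simp only: \<alpha>) (simp add: algebra_simps)
    qed simp
    also have "\<dots> = fps_const (\<alpha> j (m - 1)) * T (m - 1) - fps_const (\<alpha> j 0) * T 0"
      by (rule sum_lessThan_telescope)
    \<comment> \<open>The root equation gives \<open>\<alpha> j (m - 1) = 1\<close>, while
      \<open>\<alpha> j 0 = m!\<close>.\<close>
    also have "\<dots> = T (m - 1) - fact m * H"
      using pochhammer_root[OF j] by (simp add: \<alpha>_def T_def fps_const_fact)
    finally show ?thesis .
  qed
  \<comment> \<open>After the exchange of sums, \<open>sum_inverse_pochhammer_roots\<close> leaves
    only \<open>T 0 = H\<close>.\<close>
  have "(\<Sum>j = 1..m - 1. fps_const (1 / d j) * F j) =
      (\<Sum>k<m - 1. fps_const (\<Sum>j = 1..m - 1. \<alpha> j (Suc k) / d j) * T k)"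
    unfolding F_def sum_distrib_left
    by (subst sum.swap)
      (simp add: sum_distrib_right fps_const_sum flip: mult.assoc)
  also have "\<dots> = (\<Sum>k<m - 1. if k = 0 then H else 0)"
    by (rule sum.cong)
      (use sum_inverse_pochhammer_roots in \<open>auto simp: \<alpha>_def d_def T_def\<close>)
  also have "\<dots> = H"
    using m by simp
  finally have "H = (\<Sum>j = 1..m - 1. fps_const (1 / d j) * F j)" ..
  also have "\<dots> = (\<Sum>j = 1..m - 1. fps_const (1 / d j) * (one_minus_z_powr (- lam j) *
       (fps_const (F j $ 0) + fps_integral0 (one_minus_z_powr (lam j - 1) * (T (m - 1) - fact m * H)))))"
    by (intro sum.cong refl arg_cong[where f = "\<lambda>x. _ * x"] one_minus_z_powr_first_order ode)
  finally show ?thesis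
    by (simp add: F_nth_0 \<alpha>_def d_def T_def mult.assoc)
qed

end

section \<open>From the recurrence to the two formulas\<close>

theorem theorem2p2:
  fixes m :: nat and a b :: "nat \<Rightarrow> complex" and lam c :: "nat \<Rightarrow> complex"
    and A B Bhat :: "complex fps"
  assumes "m \<ge> 2"
    and "\<And>j. j \<le> m - 2 \<Longrightarrow> a j = b j"
    and "\<And>n. n \<ge> m - 1 \<Longrightarrow>
           a n = b n + of_nat m / of_nat (n choose (m - 1)) *
             (\<Sum>j = 0..n - (m - 1). of_nat ((n - 1 - j) choose (m - 2)) * a j)"
    and "A = Abs_fps a"
    and "B = Abs_fps b"
    and "Bhat = Abs_fps (\<lambda>n. if n \<ge> m - 1 then b n else 0)"
    and "psi m = (\<Prod>j = 1..m - 1. [:- lam j, 1:])"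
    and "lam 1 = 2"
    and "\<And>i j. 1 \<le> i \<Longrightarrow> i \<le> j \<Longrightarrow> j \<le> m - 1 \<Longrightarrow> Re (lam j) \<le> Re (lam i)"
    and "\<And>j. 1 \<le> j \<Longrightarrow> j \<le> m - 1 \<Longrightarrow>
           c j = fact m / poly (pderiv (psi m)) (lam j) *
             (\<Sum>k = 0..m - 2. b k * (fact k / (\<Prod>i = 0..k. lam j + of_nat i)))"
  shows "A = (\<Sum>j = 1..m - 1. fps_const (c j) * one_minus_z_powr (- lam j))
           + (\<Sum>j = 1..m - 1.
                fps_const (1 / poly (pderiv (psi m)) (lam j)) * one_minus_z_powr (- lam j) *
                fps_integral0 (fps_nth_deriv (m - 1) B *
                  one_minus_z_powr (lam j + of_nat m - 2)))
       \<and> A = (\<Sum>j = 1..m - 1. fps_const (c j) * one_minus_z_powr (- lam j))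
           + Bhat
           + fact m * (\<Sum>j = 1..m - 1.
                fps_const (1 / poly (pderiv (psi m)) (lam j)) * one_minus_z_powr (- lam j) *
                fps_integral0 (Bhat * one_minus_z_powr (lam j - 1)))"
proof -
  note [simp del] = fps_nth_deriv.simps
  have m: "m \<ge> 2" and ab: "\<And>j. j \<le> m - 2 \<Longrightarrow> a j = b j" and A: "A = Abs_fps a"
    and B: "B = Abs_fps b" and Bhat: "Bhat = Abs_fps (\<lambda>n. if n \<ge> m - 1 then b n else 0)"
    and psi: "psi m = (\<Prod>j = 1..m - 1. [:- lam j, 1:])"
    by fact+
  define N where "N = m - 1"
  have N: "N > 0" "m = Suc N" "m - 2 = N - 1" "{0..m - 2} = {..<N}"
    using m by (auto simp: N_def)
  \<comment> \<open>The exponent is \<open>(lam j - 1) + N\<close>: the integrating factor times the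
    power of \<open>1 - z\<close> in front of \<open>B^(N)\<close>.\<close>
  have shift: "one_minus_z_powr (lam j + of_nat m - 2) =
      one_minus_z_powr (lam j - 1) * one_minus_z_powr (of_nat N)" for j
    by (simp add: N(2) algebra_simps flip: one_minus_z_powr_add)
  \<comment> \<open>The \<open>N\<close>-th derivative sees only coefficients of index at least
    \<open>N\<close>, where \<open>Bhat\<close> and \<open>B\<close> agree.\<close>
  have DBhat: "fps_nth_deriv N Bhat = fps_nth_deriv N B"
    by (rule fps_ext) (simp add: fps_nth_deriv_nth Bhat B N_def)
  have recurrence: "fps_nth_deriv N A =
      fps_nth_deriv N B + fact m * (one_minus_z_powr (- of_nat N) * A)"
  proof (rule fps_ext)
    fix n
    define S where "S = (\<Sum>j = 0..n. of_nat ((n + N - 1 - j) choose (N - 1)) * a j)"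
    have "(A * one_minus_z_powr (- of_nat N)) $ n = S"
      unfolding fps_mult_nth S_def A
      by (rule sum.cong) (use N in \<open>auto simp: one_minus_z_powr_uminus_of_nat_nth\<close>)
    then have "(fact m * (one_minus_z_powr (- of_nat N) * A)) $ n = fact m * S"
      by (simp add: mult.commute[of _ A] flip: fps_const_fact)
    moreover have "a (n + N) = b (n + N) + of_nat m / of_nat ((n + N) choose N) * S"
      using assms(3)[of "n + N"] by (simp add: N S_def)
    \<comment> \<open>Differentiation multiplies the coefficient of index \<open>n + N\<close> by
      this number, which clears the binomial and turns \<open>m\<close> into
      \<open>m * N! = m!\<close>.\<close>
    moreover have "pochhammer (of_nat n + 1) N = (fact N * of_nat ((n + N) choose N) :: complex)"
      by (simp add: binomial_gbinomial gbinomial_pochhammer' add.commute)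
    ultimately show "fps_nth_deriv N A $ n =
        (fps_nth_deriv N B + fact m * (one_minus_z_powr (- of_nat N) * A)) $ n"
      by (simp add: fps_nth_deriv_nth A B N(2) field_simps)
  qed
  have GA: "one_minus_z_powr (of_nat N) * fps_nth_deriv N A - fact m * A =
      one_minus_z_powr (of_nat N) * fps_nth_deriv N B"
  proof -
    have "one_minus_z_powr (of_nat N) * fps_nth_deriv N A =
        one_minus_z_powr (of_nat N) * fps_nth_deriv N B
        + fact m * A * (one_minus_z_powr (- of_nat N) * one_minus_z_powr (of_nat N))"
      by (simp add: recurrence algebra_simps)
    then show ?thesis by (simp add: one_minus_z_powr_uminus_mult)
  qed
  define d where "d j = poly (pderiv (psi m)) (lam j)" for j
  define P where "P j = fps_const (1 / d j) * one_minus_z_powr (- lam j)" for j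
  define I where "I j = fps_integral0 (fps_nth_deriv N B * one_minus_z_powr (lam j + of_nat m - 2))" for j
  define J where "J j = fps_integral0 (Bhat * one_minus_z_powr (lam j - 1))" for j
  \<comment> \<open>\<open>c j\<close> is \<open>F_j(0) / \<psi>'(lam j)\<close> for
    \<open>H = A\<close>: only coefficients of index at most \<open>m - 2\<close> enter, and there
    \<open>a\<close> and \<open>b\<close> agree.\<close>
  have c: "fps_const (c j) * one_minus_z_powr (- lam j) =
      P j * fps_const (\<Sum>k<N. fact m / pochhammer (lam j) (Suc k) * (fact k * A $ k))"
    if "j \<in> {1..m - 1}" for j
  proof -
    have "c j = fact m / d j * (\<Sum>k<N. b k * (fact k / pochhammer (lam j) (Suc k)))"
      using that assms(10)[of j] unfolding N(4) by (simp add: d_def pochhammer_Suc_prod)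
    also have "\<dots> = 1 / d j * (\<Sum>k<N. fact m / pochhammer (lam j) (Suc k) * (fact k * A $ k))"
      unfolding sum_distrib_left
      by (rule sum.cong) (use ab in \<open>auto simp: N(3) A\<close>)
    finally have "c j = 1 / d j * (\<Sum>k<N. fact m / pochhammer (lam j) (Suc k) * (fact k * A $ k))" .
    then show ?thesis by (simp add: P_def mult_ac)
  qed
  have "A = (\<Sum>j = 1..m - 1. P j *
      (fps_const (\<Sum>k<N. fact m / pochhammer (lam j) (Suc k) * (fact k * A $ k)) + I j))"
    using fps_expansion_over_roots[OF m psi, of A]
    unfolding N_def[symmetric] GA P_def I_def d_def shift by (simp add: mult_ac)
  then have 1: "A = (\<Sum>j = 1..m - 1. fps_const (c j) * one_minus_z_powr (- lam j))
      + (\<Sum>j = 1..m - 1. P j * I j)"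
    by (simp add: c distrib_left sum.distrib)
  \<comment> \<open>Hence every \<open>F_j(0)\<close> vanishes for \<open>H = Bhat\<close>, and only
    the integrals remain.\<close>
  have "Bhat $ k = 0" if "k < N" for k
    using that by (simp add: Bhat N)
  then have "Bhat = (\<Sum>j = 1..m - 1. P j * fps_integral0 (one_minus_z_powr (lam j - 1) *
        (one_minus_z_powr (of_nat N) * fps_nth_deriv N B - fact m * Bhat)))"
    using fps_expansion_over_roots[OF m psi, of Bhat]
    unfolding N_def[symmetric] DBhat P_def d_def by simp
  also have "\<dots> = (\<Sum>j = 1..m - 1. P j * (I j - fact m * J j))"
  proof -
    have "fps_integral0 (one_minus_z_powr (lam j - 1) *
        (one_minus_z_powr (of_nat N) * fps_nth_deriv N B - fact m * Bhat)) = I j - fact m * J j" for j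
      using fps_integral0_fps_const_mult_left[of "fact m" "Bhat * one_minus_z_powr (lam j - 1)"]
      by (simp add: I_def J_def shift right_diff_distrib fps_integral0_sub fps_const_fact mult_ac)
    then show ?thesis by simp
  qed
  \<comment> \<open>Solved for the integral part of the first formula; insertion into
    \<open>1\<close> gives the second.\<close>
  finally have 2: "(\<Sum>j = 1..m - 1. P j * I j) = Bhat + fact m * (\<Sum>j = 1..m - 1. P j * J j)"
    by (simp add: right_diff_distrib sum_subtractf sum_distrib_left mult_ac)
  show ?thesis
    using 1 2 unfolding P_def I_def J_def d_def N_def by (simp add: add.assoc)
qed

end
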